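(* In the setting described in the context, let $\mathcal S$ be an infinite unbounded set of non-negative real numbers, let $\alpha$ be a real-valued function with $0\le\alpha<M$ for some constant $M<\infty$, let $h_0$ be a positive monotonically increasing function with $h_0(T)\to\infty$ as $T\to\infty$, let $c_5,c_6,c_7>0$ be constants, and put $$\mathcal A_T=\{x\in[T/2,T]: x\ge 1,\ |\Delta(x)|>c_5x^{\alpha(x)}\}.$$ Assume that for all $T\in\mathcal S$: (i) $\displaystyle\int_{\mathcal A_T}\frac{\Delta^2(x)}{x^{2\alpha(T)+1}}\,dx>c_6$; (ii) $\mu(\mathcal A_T)<c_7h_0(T)$; (iii) the function $x\mapsto x^{\alpha(x)+1/2}h_0(x)^{-1/2}$ is monotonically increasing for $x\in[T/2,T]$. Let $c_8=\sqrt{\dfrac{c_6}{2^{2M+1}c_7}}$. Then there exists $T_0$ such that for every $T\in\mathcal S$ with $T>T_0$ there is some $x\in[T/2,T]$ with $$|\Delta(x)|>c_8\,x^{\alpha(x)+1/2}h_0(x)^{-1/2}.$$ In particular $\Delta(x)=\Omega\big(x^{\alpha(x)+1/2}h_0(x)^{-1/2}\big)$.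
   Context: Let $\{a_n\}_{n\ge1}$ be a sequence of real numbers and $D(s)=\sum_{n\ge1}a_nn^{-s}$. Suppose there are real numbers $0<\sigma_1<\sigma_2$ such that $D(s)$ converges absolutely for $\Re(s)>\sigma_2$ and can be meromorphically continued to $\Re(s)>\sigma_1$ with only finitely many poles $\rho$ there, all with $\sigma_1<\Re(\rho)\le\sigma_2$; let $\mathcal P$ be the set of these poles and $\mathcal M(x)=\sum_{\rho\in\mathcal P}\mathrm{Res}_{s=\rho}\left(\frac{D(s)x^s}{s}\right)$. For $x\ge1$ let $\Delta(x)=\sum^*_{n\le x}a_n-\mathcal M(x)$, where $\sum^*_{n\le x}a_n=\sum_{n\le x}a_n$ if $x\notin\mathbb N$ and $\sum_{n\le x}a_n-\frac12a_x$ if $x\in\mathbb N$. $\mu$ is Lebesgue measure. $f(x)=\Omega(g(x))$ means $\limsup_{x\to\infty}|f(x)|/g(x)>0$. *)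

theory Defs
  imports "HOL-Complex_Analysis.Complex_Analysis"
begin

definition dirichlet_term :: "(nat \<Rightarrow> real) \<Rightarrow> complex \<Rightarrow> nat \<Rightarrow> complex" where
  "dirichlet_term a s n = of_real (a n) * of_nat n powr (- s)"

definition dirichlet_series :: "(nat \<Rightarrow> real) \<Rightarrow> complex \<Rightarrow> complex" where
  "dirichlet_series a s = infsum (dirichlet_term a s) {1..}"

definition poles_right_of :: "(complex \<Rightarrow> complex) \<Rightarrow> real \<Rightarrow> complex set" where
  "poles_right_of D \<sigma> = {\<rho>. \<sigma> < Re \<rho> \<and> is_pole D \<rho>}"

definition main_term :: "(complex \<Rightarrow> complex) \<Rightarrow> real \<Rightarrow> real \<Rightarrow> complex" where
  "main_term D \<sigma> x =
     (\<Sum>\<rho>\<in>poles_right_of D \<sigma>. residue (\<lambda>s. D s * of_real x powr s / s) \<rho>)"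

definition sum_star :: "(nat \<Rightarrow> real) \<Rightarrow> real \<Rightarrow> real" where
  "sum_star a x =
     (\<Sum>n | 1 \<le> n \<and> real n \<le> x. a n) - (if x \<in> \<nat> then a (nat \<lfloor>x\<rfloor>) / 2 else 0)"

(* The coefficients are real, so a meromorphic continuation D satisfies
   D(conj s) = conj (D s) off a discrete set; hence the residues at conjugate
   poles are conjugate and main_term D \<sigma> x is real.
   Re only changes the type.  Meaningful for x \<ge> 1. *)
definition error_term :: "(nat \<Rightarrow> real) \<Rightarrow> (complex \<Rightarrow> complex) \<Rightarrow> real \<Rightarrow> real \<Rightarrow> real" where
  "error_term a D \<sigma> x = sum_star a x - Re (main_term D \<sigma> x)"

definition large_error_set :: "(real \<Rightarrow> real) \<Rightarrow> real \<Rightarrow> (real \<Rightarrow> real) \<Rightarrow> real \<Rightarrow> real set" where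
  "large_error_set \<Delta> c \<alpha> T = {x \<in> {T/2..T}. 1 \<le> x \<and> \<bar>\<Delta> x\<bar> > c * x powr \<alpha> x}"

(* The limsup version of Omega, i.e. the negation of f = o(g) for eventually
   positive g.  It is weaker than bigomega of HOL-Library.Landau_Symbols, which
   demands the lower bound for all large x. *)
definition limsup_Omega :: "(real \<Rightarrow> real) \<Rightarrow> (real \<Rightarrow> real) \<Rightarrow> bool" where
  "limsup_Omega f g \<longleftrightarrow> Limsup at_top (\<lambda>x. ereal (\<bar>f x\<bar> / g x)) > 0"

end

theory Submission imports Defs begin

text \<open>The argument is a comparison of a mean square with a maximum.  Write
  \<open>g x = x powr (\<alpha> x + 1/2) * h0 x powr (-1/2)\<close> and suppose that \<open>\<bar>\<Delta>\<bar> \<le> c8 * g\<close> on all of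
  \<open>[T/2, T]\<close>.  Monotonicity of \<open>g\<close> replaces \<open>g x\<close> by its value at the right end point, so
  \<open>\<Delta>\<^sup>2 \<le> c8\<^sup>2 * T powr (2 * \<alpha> T + 1) / h0 T\<close> there; the weight \<open>x powr (2 * \<alpha> T + 1)\<close> has the
  same order of magnitude as \<open>T powr (2 * \<alpha> T + 1)\<close>, the loss being at most a factor
  \<open>2 powr (2 * M + 1)\<close>.  Hence the integrand of the mean square is at most
  \<open>c8\<^sup>2 * 2 powr (2 * M + 1) / h0 T\<close>, and it is integrated over a set of measure below
  \<open>c7 * h0 T\<close>: the integral is at most \<open>c8\<^sup>2 * 2 powr (2 * M + 1) * c7 = c6\<close>, against the
  assumed lower bound (\<open>dyadic_window_peak\<close>).  The constant \<open>c8\<close> is exactly the one for which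
  this is a contradiction.

  The peaks lie in windows \<open>[T/2, T]\<close> with \<open>T\<close> unbounded, so they recur at arbitrarily large
  \<open>x\<close>, which is the \<open>\<Omega>\<close> statement (\<open>limsup_Omega_if_frequently\<close>).

  Bounding an integral by a supremum times a measure requires a measurable domain.  Instead of
  tracing the dependence of \<open>\<Delta>\<close> on \<open>x\<close> through the residues, the proof extracts this
  measurability from the positivity of the integral (\<open>set_lebesgue_integral_pos_le\<close>).\<close>

text \<open>A nonzero Bochner integral is one of an integrable function, because the integral of any
  other function is \<open>0\<close> by convention.  As \<open>f\<close> does not vanish on \<open>A\<close>, the set \<open>A\<close> is the
  support of the integrable function \<open>indicator A * f\<close> and therefore measurable.\<close>

lemma set_lebesgue_integral_pos_le:
  fixes f :: "real \<Rightarrow> real"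
  assumes int_pos: "(LINT x:A|lebesgue. f x) > 0"
    and "bounded A"
    and nonzero: "\<And>x. x \<in> A \<Longrightarrow> f x \<noteq> 0"
    and le: "\<And>x. x \<in> A \<Longrightarrow> f x \<le> K"
  shows "(LINT x:A|lebesgue. f x) \<le> K * measure lebesgue A"
proof -
  have integrable: "integrable lebesgue (\<lambda>x. indicator A x *\<^sub>R f x)"
    using int_pos not_integrable_integral_eq
    unfolding set_lebesgue_integral_def by fastforce
  have "{x \<in> space lebesgue. indicator A x *\<^sub>R f x \<noteq> 0} \<in> sets lebesgue"
    using borel_measurable_integrable[OF integrable] by measurable
  moreover have "{x \<in> space lebesgue. indicator A x *\<^sub>R f x \<noteq> 0} = A"
    using nonzero by (auto simp: indicator_def)
  ultimately have "A \<in> sets lebesgue"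
    by metis
  then have "A \<in> lmeasurable"
    by (rule bounded_set_imp_lmeasurable[OF \<open>bounded A\<close>])
  then have "integrable lebesgue (\<lambda>x. indicator A x *\<^sub>R K)"
    by (auto simp: fmeasurable_def)
  with integrable have "(LINT x:A|lebesgue. f x) \<le> (LINT x:A|lebesgue. K)"
    unfolding set_lebesgue_integral_def
    by (rule integral_mono) (auto simp: indicator_def le)
  also have "\<dots> = K * measure lebesgue A"
    by (simp add: set_lebesgue_integral_def)
  finally show ?thesis .
qed

lemma limsup_Omega_if_frequently:
  assumes "c > 0" and "\<exists>\<^sub>F x in at_top. c \<le> \<bar>f x\<bar> / g x"
  shows "limsup_Omega f g"
proof -
  have "ereal c \<le> Limsup at_top (\<lambda>x. ereal (\<bar>f x\<bar> / g x))"
  proof (rule ccontr)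
    assume "\<not> ?thesis"
    then have "\<forall>\<^sub>F x in at_top. ereal (\<bar>f x\<bar> / g x) < ereal c"
      by (intro Limsup_lessD) simp
    then show False
      using assms(2) by (auto simp: frequently_def not_le)
  qed
  with \<open>c > 0\<close> show ?thesis
    unfolding limsup_Omega_def by (meson ereal_less(2) less_le_trans)
qed

text \<open>The exponent is the same in the bound for \<open>\<delta>\<close> and in the weight, so that
  \<open>x \<ge> T/2\<close> costs only the factor \<open>2 powr (2 * \<beta> + 1)\<close>.  It is enlarged with \<open>\<kappa>\<close> because the
  constant must not depend on the window, whereas \<open>\<beta> = \<alpha> T\<close> does.\<close>

lemma weighted_square_le:
  fixes \<delta> x T \<beta> \<kappa> h c :: real
  assumes "0 < T" and "T/2 \<le> x" and "0 \<le> \<beta>" and "\<beta> \<le> \<kappa>" and "0 < h"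
    and "\<bar>\<delta>\<bar> \<le> c * (T powr (\<beta> + 1/2) * h powr (-1/2))"
  shows "\<delta>\<^sup>2 / x powr (2 * \<beta> + 1) \<le> c\<^sup>2 * 2 powr (2 * \<kappa> + 1) / h"
proof -
  have "\<delta>\<^sup>2 \<le> (c * (T powr (\<beta> + 1/2) * h powr (-1/2)))\<^sup>2"
    using assms(6) by (metis abs_ge_zero power2_abs power_mono)
  also have "\<dots> = c\<^sup>2 * T powr (2 * \<beta> + 1) / h"
    using \<open>0 < T\<close> \<open>0 < h\<close>
    by (simp add: power_mult_distrib powr_power powr_minus_divide power_divide
        distrib_right mult.commute)
  also have "T powr (2 * \<beta> + 1) = 2 powr (2 * \<beta> + 1) * (T/2) powr (2 * \<beta> + 1)"
    using powr_mult[of 2 "T/2" "2 * \<beta> + 1"] \<open>0 < T\<close> by simp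
  also have "c\<^sup>2 * (2 powr (2 * \<beta> + 1) * (T/2) powr (2 * \<beta> + 1)) / h
      \<le> c\<^sup>2 * (2 powr (2 * \<kappa> + 1) * x powr (2 * \<beta> + 1)) / h"
    using assms(1-5)
    by (intro divide_right_mono mult_left_mono mult_mono powr_mono powr_mono2) auto
  finally have "\<delta>\<^sup>2 \<le> c\<^sup>2 * 2 powr (2 * \<kappa> + 1) / h * x powr (2 * \<beta> + 1)"
    by (simp add: mult_ac)
  then show ?thesis
    using assms(1,2) by (simp add: pos_divide_le_eq)
qed

text \<open>The comparison on a single window.  On the set of large errors
  \<open>\<bar>\<Delta> x\<bar> > c5 * x powr \<alpha> x > 0\<close>, so the integrand does not vanish there, which is what lets
  the measurability of that set follow from the positivity of the mean square.\<close>

lemma dyadic_window_peak: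
  fixes \<Delta> \<alpha> h :: "real \<Rightarrow> real" and T M c5 c6 c7 :: real
  assumes "0 < T" and "0 \<le> \<alpha> T" and "\<alpha> T \<le> M" and "0 < h T"
    and "0 < c5" and "0 < c6" and "0 < c7"
    and mean_square:
      "(LINT x:large_error_set \<Delta> c5 \<alpha> T|lebesgue. (\<Delta> x)\<^sup>2 / x powr (2 * \<alpha> T + 1)) > c6"
    and measure_le: "measure lebesgue (large_error_set \<Delta> c5 \<alpha> T) \<le> c7 * h T"
    and mono: "mono_on {T/2..T} (\<lambda>x. x powr (\<alpha> x + 1/2) * h x powr (-1/2))"
  shows "\<exists>x\<in>{T/2..T}. \<bar>\<Delta> x\<bar> >
    sqrt (c6 / (2 powr (2 * M + 1) * c7)) * x powr (\<alpha> x + 1/2) * h x powr (-1/2)"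
proof (rule ccontr)
  define c where "c = sqrt (c6 / (2 powr (2 * M + 1) * c7))"
  define g where "g = (\<lambda>x. x powr (\<alpha> x + 1/2) * h x powr (-1/2))"
  define K where "K = c\<^sup>2 * 2 powr (2 * M + 1) / h T"
  let ?A = "large_error_set \<Delta> c5 \<alpha> T"
  assume "\<not> ?thesis"
  then have small: "\<bar>\<Delta> x\<bar> \<le> c * g x" if "x \<in> {T/2..T}" for x
    using that by (auto simp: c_def g_def mult.assoc not_less)
  have "c \<ge> 0"
    using assms(6,7) by (simp add: c_def)
  have "?A \<subseteq> {T/2..T}"
    by (auto simp: large_error_set_def)
  have le_K: "(\<Delta> x)\<^sup>2 / x powr (2 * \<alpha> T + 1) \<le> K" if "x \<in> ?A" for x
  proof -
    have x: "x \<in> {T/2..T}"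
      using that \<open>?A \<subseteq> _\<close> by blast
    have "\<bar>\<Delta> x\<bar> \<le> c * g x"
      by (rule small[OF x])
    also have "\<dots> \<le> c * g T"
      using x \<open>0 < T\<close> \<open>c \<ge> 0\<close> mono_onD[OF mono x, of T]
      by (intro mult_left_mono) (auto simp: g_def)
    finally show ?thesis
      unfolding K_def g_def using x assms(1-4) by (intro weighted_square_le) auto
  qed
  have "(\<Delta> x)\<^sup>2 / x powr (2 * \<alpha> T + 1) \<noteq> 0" if "x \<in> ?A" for x
  proof -
    have "0 \<le> c5 * x powr \<alpha> x"
      using \<open>0 < c5\<close> by simp
    with that show ?thesis
      by (auto simp: large_error_set_def)
  qed
  moreover have "bounded ?A"
    using bounded_closed_interval \<open>?A \<subseteq> _\<close> by (rule bounded_subset)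
  moreover have "(LINT x:?A|lebesgue. (\<Delta> x)\<^sup>2 / x powr (2 * \<alpha> T + 1)) > 0"
    using mean_square \<open>0 < c6\<close> by linarith
  ultimately have "(LINT x:?A|lebesgue. (\<Delta> x)\<^sup>2 / x powr (2 * \<alpha> T + 1))
      \<le> K * measure lebesgue ?A"
    using le_K by (intro set_lebesgue_integral_pos_le)
  also have "\<dots> \<le> K * (c7 * h T)"
    using measure_le \<open>0 < h T\<close> by (intro mult_left_mono) (auto simp: K_def)
  also have "\<dots> = c6"
    using assms(4,6,7) by (simp add: K_def c_def)
  finally show False
    using mean_square by simp
qed

theorem proposition3:
  fixes a :: "nat \<Rightarrow> real" and D :: "complex \<Rightarrow> complex"
    and \<sigma>1 \<sigma>2 :: real
    and S :: "real set" and \<alpha> h0 :: "real \<Rightarrow> real"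
    and M c5 c6 c7 c8 :: real
    and \<Delta> :: "real \<Rightarrow> real"
  assumes "0 < \<sigma>1" and "\<sigma>1 < \<sigma>2"
    and "\<And>s. Re s > \<sigma>2 \<Longrightarrow> (\<lambda>n. norm (dirichlet_term a s n)) summable_on {1..}"
    and "D meromorphic_on {s. Re s > \<sigma>1}"
    and "\<And>s. Re s > \<sigma>2 \<Longrightarrow> D s = dirichlet_series a s"
    and "finite (poles_right_of D \<sigma>1)"
    and "\<And>\<rho>. \<rho> \<in> poles_right_of D \<sigma>1 \<Longrightarrow> Re \<rho> \<le> \<sigma>2"
    and "\<Delta> = error_term a D \<sigma>1"
    and "S \<subseteq> {0..}" and "infinite S" and "\<not> bounded S"
    and "\<And>x. x \<ge> 0 \<Longrightarrow> 0 \<le> \<alpha> x \<and> \<alpha> x < M"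
    and "\<And>x. x \<ge> 0 \<Longrightarrow> h0 x > 0"
    and "mono_on {0..} h0" and "filterlim h0 at_top at_top"
    and "c5 > 0" and "c6 > 0" and "c7 > 0"
    and "\<And>T. T \<in> S \<Longrightarrow>
           (LINT x:large_error_set \<Delta> c5 \<alpha> T|lebesgue. (\<Delta> x)\<^sup>2 / x powr (2 * \<alpha> T + 1)) > c6"
    and "\<And>T. T \<in> S \<Longrightarrow> measure lebesgue (large_error_set \<Delta> c5 \<alpha> T) < c7 * h0 T"
    and "\<And>T. T \<in> S \<Longrightarrow>
           mono_on {T/2..T} (\<lambda>x. x powr (\<alpha> x + 1/2) * h0 x powr (-1/2))"
    and "c8 = sqrt (c6 / (2 powr (2 * M + 1) * c7))"
  shows "(\<exists>T0. \<forall>T\<in>S. T > T0 \<longrightarrow>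
            (\<exists>x\<in>{T/2..T}. \<bar>\<Delta> x\<bar> > c8 * x powr (\<alpha> x + 1/2) * h0 x powr (-1/2)))
       \<and> limsup_Omega \<Delta> (\<lambda>x. x powr (\<alpha> x + 1/2) * h0 x powr (-1/2))"
proof -
  define g where "g = (\<lambda>x. x powr (\<alpha> x + 1/2) * h0 x powr (-1/2))"
  have peak: "\<exists>x\<in>{T/2..T}. \<bar>\<Delta> x\<bar> > c8 * x powr (\<alpha> x + 1/2) * h0 x powr (-1/2)"
    if "T \<in> S" "T > 0" for T
    unfolding assms(22)
  proof (rule dyadic_window_peak)
    show "0 \<le> \<alpha> T" "\<alpha> T \<le> M" "0 < h0 T"
      using assms(12)[of T] assms(13)[of T] \<open>T > 0\<close> by auto
    show "measure lebesgue (large_error_set \<Delta> c5 \<alpha> T) \<le> c7 * h0 T"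
      using assms(20)[OF \<open>T \<in> S\<close>] by simp
  qed (use that assms(16-19,21) in auto)
  have "c8 > 0"
    using assms(17,18,22) by simp
  \<comment> \<open>Every window beyond \<open>2 * X\<close> lies to the right of \<open>X\<close>, and \<open>S\<close> supplies such windows.\<close>
  have "\<exists>x\<ge>X. c8 \<le> \<bar>\<Delta> x\<bar> / g x" for X
  proof -
    have "\<exists>T\<in>S. max 0 (2 * X) < T"
    proof (rule ccontr)
      assume "\<not> ?thesis"
      then have "S \<subseteq> {0..max 0 (2 * X)}"
        using assms(9) by (force simp: not_less)
      then show False
        using assms(11) bounded_subset bounded_closed_interval by blast
    qed
    then obtain T where T: "T \<in> S" "T > 0" "T > 2 * X"
      by auto
    then obtain x where x: "x \<in> {T/2..T}" "c8 * g x < \<bar>\<Delta> x\<bar>"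
      using peak[of T] by (auto simp: g_def mult.assoc)
    have "x > 0" "x \<ge> X"
      using x(1) T by auto
    moreover have "g x > 0"
      using \<open>x > 0\<close> assms(13)[of x] by (simp add: g_def)
    ultimately show ?thesis
      using x(2) by (auto simp: pos_le_divide_eq intro!: exI[of _ x])
  qed
  then have "\<exists>\<^sub>F x in at_top. c8 \<le> \<bar>\<Delta> x\<bar> / g x"
    by (force simp: frequently_def eventually_at_top_linorder)
  then have "limsup_Omega \<Delta> g"
    by (rule limsup_Omega_if_frequently[OF \<open>c8 > 0\<close>])
  with peak show ?thesis
    unfolding g_def by blast
qed

end
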